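(* Consider the nominal linear time-varying (LPV) system $x_{k+1}=\bar A_k x_k+\bar B_k u_k$ with known matrices $\bar A_k\in\mathbb{R}^{n\times n}$, $\bar B_k\in\mathbb{R}^{n\times m}$ and initial condition $x_0=d_0$. Suppose that the controllability matrix $$\begin{bmatrix}\bar B_{r-1} & \bar A_{r-1}\bar B_{r-2} & \cdots & \Big(\prod_{i=1}^{r-1}\bar A_i\Big)\bar B_0\end{bmatrix}$$ has full rank $n$ for some positive integer $r\le n$, and let $M$ be the deadbeat horizon, i.e. the smallest positive integer such that $$\mathcal{P}^\theta_M=\begin{bmatrix}\Big(\prod_{i=1}^{M-1}\bar A_i\Big)\bar B_0 & \Big(\prod_{i=2}^{M-1}\bar A_i\Big)\bar B_1 & \cdots & \bar A_{M-1}\bar B_{M-2} & \bar B_{M-1}\end{bmatrix}\in\mathbb{R}^{n\times Mm}$$ has full rank $n$. Then there exist $M$ linear feedback gains $\bar K^\theta_0,\dots,\bar K^\theta_{M-1}\in\mathbb{R}^{m\times n}$ such that with the inputs $u_j=\bar K^\theta_j d_0$, $j=0,\dots,M-1$, one has $x_M=0$ for any initial condition $d_0\in\mathbb{R}^n$.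
   Context: Products of matrices are ordered with decreasing index from left to right: $\prod_{i=a}^{b}\bar A_i=\bar A_b\bar A_{b-1}\cdots\bar A_a$, with the empty product equal to the identity. The gains may depend on the matrices $\bar A_k,\bar B_k$ but not on $d_0$. *)

theory Defs
  imports "Jordan_Normal_Form.DL_Rank"
begin

text \<open>The ordered product \<open>A b * A (b - 1) * \<dots> * A a\<close> of \<open>n \<times> n\<close> matrices; it is the identity
  if \<open>b < a\<close>.\<close>

definition mat_prod :: "nat \<Rightarrow> (nat \<Rightarrow> real mat) \<Rightarrow> nat \<Rightarrow> nat \<Rightarrow> real mat" where
  "mat_prod n A a b = foldl (\<lambda>P i. A i * P) (1\<^sub>m n) [a..<Suc b]"

text \<open>The block row \<open>[F 0, F 1, \<dots>, F (N - 1)]\<close> of \<open>N\<close> blocks, each of size \<open>n \<times> m\<close>.\<close>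

definition block_row :: "nat \<Rightarrow> nat \<Rightarrow> nat \<Rightarrow> (nat \<Rightarrow> real mat) \<Rightarrow> real mat" where
  "block_row n m N F = mat n (N * m) (\<lambda>(i, c). F (c div m) $$ (i, c mod m))"

definition controllability_mat ::
  "nat \<Rightarrow> nat \<Rightarrow> (nat \<Rightarrow> real mat) \<Rightarrow> (nat \<Rightarrow> real mat) \<Rightarrow> nat \<Rightarrow> real mat" where
  "controllability_mat n m A B r =
     block_row n m r (\<lambda>j. mat_prod n A (r - j) (r - 1) * B (r - 1 - j))"

text \<open>The same blocks, in the opposite order. The index \<open>M\<close> is meant to be positive.\<close>

definition deadbeat_mat ::
  "nat \<Rightarrow> nat \<Rightarrow> (nat \<Rightarrow> real mat) \<Rightarrow> (nat \<Rightarrow> real mat) \<Rightarrow> nat \<Rightarrow> real mat" where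
  "deadbeat_mat n m A B M = block_row n m M (\<lambda>j. mat_prod n A (j + 1) (M - 1) * B j)"

definition deadbeat_horizon ::
  "nat \<Rightarrow> nat \<Rightarrow> (nat \<Rightarrow> real mat) \<Rightarrow> (nat \<Rightarrow> real mat) \<Rightarrow> nat" where
  "deadbeat_horizon n m A B = (LEAST M. 0 < M \<and> vec_space.rank n (deadbeat_mat n m A B M) = n)"

primrec ltv_state ::
  "(nat \<Rightarrow> real mat) \<Rightarrow> (nat \<Rightarrow> real mat) \<Rightarrow> (nat \<Rightarrow> real vec) \<Rightarrow> real vec \<Rightarrow> nat \<Rightarrow> real vec" where
  "ltv_state A B u d0 0 = d0"
| "ltv_state A B u d0 (Suc k) = A k *\<^sub>v ltv_state A B u d0 k + B k *\<^sub>v u k"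

end

theory Submission
  imports Defs
begin

text \<open>
  The state after \<open>k\<close> steps is affine in the stacked input vector: it equals \<open>T d\<^sub>0 + P\<^sub>k U\<close>, where
  \<open>T\<close> is the product of the \<open>A\<^sub>i\<close> with \<open>i < k\<close> and \<open>P\<^sub>k\<close> is the deadbeat matrix (\<open>ltv_state_eq\<close>). If
  \<open>P\<^sub>M\<close> has full row rank, then its columns span the whole space, so it has a right inverse \<open>R\<close>
  (\<open>full_row_rank_right_inverse\<close>), and \<open>U = - R T d\<^sub>0\<close> steers \<open>d\<^sub>0\<close> to zero. This \<open>U\<close> is linear
  in \<open>d\<^sub>0\<close>, and the \<open>M\<close> block rows of \<open>- R T\<close> are the gains.

  The horizon \<open>M\<close> is defined as a least element, so it has the stated rank only because some
  admissible horizon exists. The number \<open>r\<close> is one: the controllability matrix and the deadbeat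
  matrix for \<open>r\<close> have the same set of columns, hence the same rank.
\<close>

section \<open>Matrices of full row rank\<close>

text \<open>A maximal independent set of columns has as many elements as the dimension of the space, so
  it is a basis, and every vector is a combination of columns.\<close>

lemma (in vec_space) full_row_rank_surj:
  assumes P: "P \<in> carrier_mat n nc" and rank: "rank P = n" and y: "y \<in> carrier_vec n"
  obtains x where "x \<in> carrier_vec nc" and "P *\<^sub>v x = y"
proof -
  have cols: "set (cols P) \<subseteq> carrier_vec n"
    using P cols_dim by blast
  obtain S where S: "maximal S (\<lambda>T. T \<subseteq> set (cols P) \<and> lin_indpt T)"
    using maximal_exists_superset[of "set (cols P)" "\<lambda>T. T \<subseteq> set (cols P) \<and> lin_indpt T" "{}"]
    by (metis List.finite_set empty_subsetI finite_lin_indpt2 finite.emptyI empty_iff)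
  then have sub: "S \<subseteq> set (cols P)" and li: "lin_indpt S"
    by (auto simp: maximal_def)
  have "card S = n"
    using rank_card_indpt[OF P S] rank by simp
  then have "basis S"
    using sub cols li finite_subset[OF sub] by (intro dim_li_is_basis) (auto simp: dim_is_n)
  then have "y \<in> span S"
    using y by (auto simp: basis_def)
  then have "y \<in> col_space P"
    using span_is_monotone[OF sub] by (auto simp: col_space_def)
  then show thesis
    using that P by (auto simp: col_space_eq[OF P])
qed

lemma full_row_rank_right_inverse:
  fixes P :: "'a :: field mat"
  assumes P: "P \<in> carrier_mat n nc" and rank: "vec_space.rank n P = n"
  obtains R where "R \<in> carrier_mat nc n" and "P * R = 1\<^sub>m n"
proof -
  interpret vec_space "TYPE('a)" n .
  have "\<exists>x. x \<in> carrier_vec nc \<and> P *\<^sub>v x = unit_vec n i" for i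
    using full_row_rank_surj[OF P rank unit_vec_carrier] by metis
  then obtain x where x: "\<And>i. x i \<in> carrier_vec nc" and Px: "\<And>i. P *\<^sub>v x i = unit_vec n i"
    by metis
  define R where "R = mat_of_cols nc (map x [0..<n])"
  have R: "R \<in> carrier_mat nc n"
    by (simp add: R_def mat_of_cols_def)
  have "col (P * R) i = col (1\<^sub>m n) i" if "i < n" for i
  proof -
    have "col R i = x i"
      using that x by (simp add: R_def)
    then show ?thesis
      using that Px col_mult2[OF P R that] by simp
  qed
  then have "P * R = 1\<^sub>m n"
    using P R by (intro mat_col_eqI) auto
  with R show thesis by (rule that)
qed

section \<open>Block rows\<close>

lemma block_row_carrier [simp]: "block_row n m N F \<in> carrier_mat n (N * m)"
  by (simp add: block_row_def)

lemma div_mod_less_blocks: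
  fixes c :: nat
  assumes "c < N * m"
  shows "c div m < N" and "c mod m < m"
  using assms by (simp_all add: less_mult_imp_div_less, cases m) simp_all

lemma block_row_cong:
  assumes "\<And>j. j < N \<Longrightarrow> F j = G j"
  shows "block_row n m N F = block_row n m N G"
  using assms by (intro eq_matI) (simp_all add: block_row_def div_mod_less_blocks)

lemma block_row_mult_left:
  assumes G: "G \<in> carrier_mat n n" and F: "\<And>j. j < N \<Longrightarrow> F j \<in> carrier_mat n m"
  shows "block_row n m N (\<lambda>j. G * F j) = G * block_row n m N F"
proof (rule eq_matI)
  fix i c assume "i < dim_row (G * block_row n m N F)" "c < dim_col (G * block_row n m N F)"
  then have i: "i < n" and c: "c < N * m"
    using G by (auto simp: block_row_def)
  note b = div_mod_less_blocks[OF c]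
  have "col (F (c div m)) (c mod m) = col (block_row n m N F) c"
    using F[OF b(1)] b(2) c by (intro eq_vecI) (auto simp: block_row_def)
  then show "block_row n m N (\<lambda>j. G * F j) $$ (i, c) = (G * block_row n m N F) $$ (i, c)"
    using F[OF b(1)] b(2) c i G by (simp add: block_row_def)
qed (use G in \<open>auto simp: block_row_def\<close>)

definition stack_vec :: "nat \<Rightarrow> nat \<Rightarrow> (nat \<Rightarrow> real vec) \<Rightarrow> real vec" where
  "stack_vec m N u = vec (N * m) (\<lambda>c. u (c div m) $ (c mod m))"

lemma stack_vec_carrier [simp]: "stack_vec m N u \<in> carrier_vec (N * m)"
  by (simp add: stack_vec_def)

lemma block_row_Suc_mult_stack_vec:
  assumes F: "F N \<in> carrier_mat n m" and u: "u N \<in> carrier_vec m"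
  shows "block_row n m (Suc N) F *\<^sub>v stack_vec m (Suc N) u =
    block_row n m N F *\<^sub>v stack_vec m N u + F N *\<^sub>v u N"
proof (rule eq_vecI)
  fix i assume "i < dim_vec (block_row n m N F *\<^sub>v stack_vec m N u + F N *\<^sub>v u N)"
  then have i: "i < n"
    using F by simp
  define f where "f c = F (c div m) $$ (i, c mod m) * u (c div m) $ (c mod m)" for c
  have row: "(block_row n m K F *\<^sub>v stack_vec m K u) $ i = sum f {0..<K * m}" for K
    using i by (simp add: block_row_def stack_vec_def scalar_prod_def f_def)
  have "sum f {N * m..<Suc N * m} = (\<Sum>l = 0..<m. f (l + N * m))"
    using sum.shift_bounds_nat_ivl[of f 0 "N * m" m] by (simp add: add.commute)
  also have "\<dots> = (F N *\<^sub>v u N) $ i"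
    using F u i by (auto simp: f_def scalar_prod_def intro!: sum.cong)
  finally have last: "sum f {N * m..<Suc N * m} = (F N *\<^sub>v u N) $ i" .
  have "sum f {0..<Suc N * m} = sum f {0..<N * m} + sum f {N * m..<Suc N * m}"
    by (simp add: sum.atLeastLessThan_concat)
  then show "(block_row n m (Suc N) F *\<^sub>v stack_vec m (Suc N) u) $ i =
      (block_row n m N F *\<^sub>v stack_vec m N u + F N *\<^sub>v u N) $ i"
    using i F by (simp only: row last index_add_vec dim_mult_mat_vec carrier_matD)
qed (use F in \<open>simp add: block_row_def\<close>)

text \<open>The right-hand side depends only on the set of blocks, so a reordering of the blocks does not
  change the column space, nor the rank.\<close>

lemma set_cols_block_row:
  "set (cols (block_row n m N F)) =
    (\<Union>G \<in> F ` {..<N}. (\<lambda>l. vec n (\<lambda>i. G $$ (i, l))) ` {..<m})" (is "_ = ?R")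
proof -
  have col: "col (block_row n m N F) c = vec n (\<lambda>i. F (c div m) $$ (i, c mod m))"
    if "c < N * m" for c
    using that by (auto simp: block_row_def)
  have "set (cols (block_row n m N F)) = col (block_row n m N F) ` {..<N * m}"
    by (auto simp: cols_def block_row_def)
  also have "\<dots> = ?R"
  proof (intro equalityI subsetI)
    fix v assume "v \<in> col (block_row n m N F) ` {..<N * m}"
    then show "v \<in> ?R"
      using col div_mod_less_blocks by fastforce
  next
    fix v assume "v \<in> ?R"
    then obtain j l where jl: "j < N" "l < m" and v: "v = vec n (\<lambda>i. F j $$ (i, l))"
      by auto
    have "j * m + l < Suc j * m"
      using jl by simp
    also have "\<dots> \<le> N * m"
      using jl by (intro mult_right_mono) auto
    finally have "j * m + l < N * m" .
    moreover have "col (block_row n m N F) (j * m + l) = v"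
      using jl col[OF calculation] by (simp add: v)
    ultimately show "v \<in> col (block_row n m N F) ` {..<N * m}"
      by blast
  qed
  finally show ?thesis .
qed

section \<open>The deadbeat horizon\<close>

lemma rank_deadbeat_mat_eq_rank_controllability_mat:
  assumes "0 < r"
  shows "vec_space.rank n (deadbeat_mat n m A B r) = vec_space.rank n (controllability_mat n m A B r)"
proof -
  define F where "F j = mat_prod n A (j + 1) (r - 1) * B j" for j
  define G where "G j = mat_prod n A (r - j) (r - 1) * B (r - 1 - j)" for j
  have GF: "G j = F (r - 1 - j)" if "j < r" for j
  proof -
    have "r - 1 - j + 1 = r - j"
      using that by simp
    then show ?thesis
      by (simp only: F_def G_def)
  qed
  have "G ` {..<r} = F ` (\<lambda>j. r - 1 - j) ` {..<r}"
    unfolding image_image by (rule image_cong) (auto simp: GF)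
  also have "(\<lambda>j. r - 1 - j) ` {..<r} = {..<r}"
  proof (intro equalityI subsetI)
    fix j assume "j \<in> {..<r}"
    then show "j \<in> (\<lambda>j. r - 1 - j) ` {..<r}"
      by (intro image_eqI[of _ _ "r - 1 - j"]) auto
  qed (use assms in auto)
  finally have "G ` {..<r} = F ` {..<r}" .
  then have "set (cols (block_row n m r F)) = set (cols (block_row n m r G))"
    by (simp only: set_cols_block_row)
  moreover have "deadbeat_mat n m A B r = block_row n m r F"
    by (simp add: deadbeat_mat_def F_def[abs_def])
  moreover have "controllability_mat n m A B r = block_row n m r G"
    by (simp add: controllability_mat_def G_def[abs_def])
  ultimately show ?thesis
    by (simp add: vec_space.rank_def)
qed

lemma deadbeat_horizon_full_rank:
  assumes "0 < r" and "vec_space.rank n (controllability_mat n m A B r) = n"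
  shows "0 < deadbeat_horizon n m A B"
    and "vec_space.rank n (deadbeat_mat n m A B (deadbeat_horizon n m A B)) = n"
  using LeastI[of "\<lambda>M. 0 < M \<and> vec_space.rank n (deadbeat_mat n m A B M) = n" r] assms
  by (auto simp: deadbeat_horizon_def rank_deadbeat_mat_eq_rank_controllability_mat)

section \<open>The state as a function of the stacked inputs\<close>

lemma mat_prod_empty: "b < a \<Longrightarrow> mat_prod n A a b = 1\<^sub>m n"
  by (simp add: mat_prod_def)

lemma mat_prod_Suc: "a \<le> Suc b \<Longrightarrow> mat_prod n A a (Suc b) = A (Suc b) * mat_prod n A a b"
  by (simp add: mat_prod_def)

lemma mat_prod_carrier:
  assumes "\<And>k. A k \<in> carrier_mat n n"
  shows "mat_prod n A a b \<in> carrier_mat n n"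
proof -
  have "foldl (\<lambda>P i. A i * P) (1\<^sub>m n) is \<in> carrier_mat n n" for "is"
    using assms by (induction "is" rule: rev_induct) (auto intro: mult_carrier_mat)
  then show ?thesis
    by (simp add: mat_prod_def)
qed

lemma deadbeat_mat_carrier [simp]: "deadbeat_mat n m A B k \<in> carrier_mat n (k * m)"
  by (simp add: deadbeat_mat_def)

text \<open>One more step multiplies all the earlier blocks by \<open>A k\<close> and appends \<open>B k\<close>. For \<open>k = 0\<close>
  there are no earlier blocks, so that the subtraction \<open>k - 1\<close> in their definition does no harm.\<close>

lemma deadbeat_mat_Suc_mult_stack_vec:
  assumes A: "\<And>k. A k \<in> carrier_mat n n" and B: "\<And>k. B k \<in> carrier_mat n m"
    and u: "u k \<in> carrier_vec m"
  shows "deadbeat_mat n m A B (Suc k) *\<^sub>v stack_vec m (Suc k) u =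
    A k *\<^sub>v (deadbeat_mat n m A B k *\<^sub>v stack_vec m k u) + B k *\<^sub>v u k"
proof -
  define F where "F j = mat_prod n A (j + 1) (k - 1) * B j" for j
  define G where "G j = mat_prod n A (j + 1) k * B j" for j
  have F: "F j \<in> carrier_mat n m" for j
    unfolding F_def by (rule mult_carrier_mat[OF mat_prod_carrier[of A, OF A] B])
  have Gk: "G k = B k"
    using B[of k] by (simp add: G_def mat_prod_empty)
  have "G j = A k * F j" if "j < k" for j
  proof -
    obtain k' where k': "k = Suc k'"
      using \<open>j < k\<close> by (cases k) auto
    show ?thesis
      using that k' mat_prod_Suc[of "j + 1" k' n A]
        assoc_mult_mat[OF A[of k] mat_prod_carrier[of A, OF A] B[of j]] by (simp add: F_def G_def)
  qed
  then have "block_row n m k G = A k * block_row n m k F"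
    using block_row_cong[of k G "\<lambda>j. A k * F j" n m] block_row_mult_left[OF A F] by simp
  then have "block_row n m (Suc k) G *\<^sub>v stack_vec m (Suc k) u =
      A k *\<^sub>v (block_row n m k F *\<^sub>v stack_vec m k u) + B k *\<^sub>v u k"
    using block_row_Suc_mult_stack_vec[of G k n m u] B[of k] u
      assoc_mult_mat_vec[OF A[of k] block_row_carrier stack_vec_carrier] by (simp add: Gk)
  moreover have "deadbeat_mat n m A B (Suc k) = block_row n m (Suc k) G"
    by (simp add: deadbeat_mat_def G_def[abs_def])
  moreover have "deadbeat_mat n m A B k = block_row n m k F"
    by (simp add: deadbeat_mat_def F_def[abs_def])
  ultimately show ?thesis
    by simp
qed

text \<open>The discrete variation-of-constants formula. It is stated at \<open>Suc k\<close> because \<open>mat_prod\<close>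
  includes its upper index, so that the empty transition matrix at time \<open>0\<close> is not of the
  form \<open>mat_prod n A 0 b\<close>.\<close>

lemma ltv_state_eq:
  assumes A: "\<And>k. A k \<in> carrier_mat n n" and B: "\<And>k. B k \<in> carrier_mat n m"
    and d0: "d0 \<in> carrier_vec n" and u: "\<And>j. j \<le> k \<Longrightarrow> u j \<in> carrier_vec m"
  shows "ltv_state A B u d0 (Suc k) =
    mat_prod n A 0 k *\<^sub>v d0 + deadbeat_mat n m A B (Suc k) *\<^sub>v stack_vec m (Suc k) u"
  using u
proof (induction k)
  case 0
  have "deadbeat_mat n m A B 0 *\<^sub>v stack_vec m 0 u = 0\<^sub>v n"
    by (auto simp: deadbeat_mat_def block_row_def stack_vec_def scalar_prod_def)
  moreover have "A 0 *\<^sub>v 0\<^sub>v n = 0\<^sub>v n"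
    using A[of 0] by auto
  moreover have "B 0 *\<^sub>v u 0 \<in> carrier_vec n"
    using B[of 0] 0 by auto
  moreover have "mat_prod n A 0 0 = A 0"
    using A[of 0] by (simp add: mat_prod_def)
  ultimately show ?case
    using deadbeat_mat_Suc_mult_stack_vec[of A n B m u 0, OF A B] 0 by simp
next
  case (Suc k)
  define D where "D = deadbeat_mat n m A B (Suc k) *\<^sub>v stack_vec m (Suc k) u"
  define T where "T = mat_prod n A 0 k"
  note T = mat_prod_carrier[of A n 0 k, OF A, folded T_def]
  have D: "D \<in> carrier_vec n"
    unfolding D_def by (rule mult_mat_vec_carrier[OF deadbeat_mat_carrier stack_vec_carrier])
  have c: "A (Suc k) *\<^sub>v (T *\<^sub>v d0) \<in> carrier_vec n" "A (Suc k) *\<^sub>v D \<in> carrier_vec n"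
    "B (Suc k) *\<^sub>v u (Suc k) \<in> carrier_vec n"
    using A[of "Suc k"] B[of "Suc k"] T D d0 Suc.prems by (auto intro: mult_mat_vec_carrier)
  have "ltv_state A B u d0 (Suc (Suc k)) =
      A (Suc k) *\<^sub>v (T *\<^sub>v d0 + D) + B (Suc k) *\<^sub>v u (Suc k)"
    using Suc by (simp add: D_def T_def ltv_state.simps(2)[of _ _ _ _ "Suc k"]
        del: ltv_state.simps(2))
  also have "\<dots> = A (Suc k) *\<^sub>v (T *\<^sub>v d0) + (A (Suc k) *\<^sub>v D + B (Suc k) *\<^sub>v u (Suc k))"
    using mult_add_distrib_mat_vec[OF A mult_mat_vec_carrier[OF T d0] D] c by simp
  also have "A (Suc k) *\<^sub>v (T *\<^sub>v d0) = mat_prod n A 0 (Suc k) *\<^sub>v d0"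
    using assoc_mult_mat_vec[OF A T d0] by (simp add: mat_prod_Suc T_def)
  also have "A (Suc k) *\<^sub>v D + B (Suc k) *\<^sub>v u (Suc k) =
      deadbeat_mat n m A B (Suc (Suc k)) *\<^sub>v stack_vec m (Suc (Suc k)) u"
    using deadbeat_mat_Suc_mult_stack_vec[of A n B m u "Suc k", OF A B] Suc.prems by (simp add: D_def)
  finally show ?case .
qed

section \<open>The deadbeat gains\<close>

theorem mainTheorem2:
  fixes n m r M :: nat and A B :: "nat \<Rightarrow> real mat"
  assumes "\<And>k. A k \<in> carrier_mat n n"
    and "\<And>k. B k \<in> carrier_mat n m"
    and "0 < r" and "r \<le> n"
    and "vec_space.rank n (controllability_mat n m A B r) = n"
    and "M = deadbeat_horizon n m A B"
  shows "\<exists>K :: nat \<Rightarrow> real mat.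
    (\<forall>j<M. K j \<in> carrier_mat m n) \<and>
    (\<forall>d0 \<in> carrier_vec n. \<forall>u. (\<forall>j<M. u j = K j *\<^sub>v d0) \<longrightarrow> ltv_state A B u d0 M = 0\<^sub>v n)"
proof -
  note A = assms(1) and B = assms(2)
  obtain k where M: "M = Suc k"
    using deadbeat_horizon_full_rank(1)[OF assms(3,5)] assms(6) gr0_implies_Suc by blast
  define P where "P = deadbeat_mat n m A B M"
  define T where "T = mat_prod n A 0 k"
  have P: "P \<in> carrier_mat n (M * m)" and T: "T \<in> carrier_mat n n"
    using mat_prod_carrier[of A, OF A] by (auto simp: P_def T_def)
  have "vec_space.rank n P = n"
    using deadbeat_horizon_full_rank(2)[OF assms(3,5)] by (simp add: P_def assms(6))
  then obtain R where R: "R \<in> carrier_mat (M * m) n" and PR: "P * R = 1\<^sub>m n"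
    using full_row_rank_right_inverse[OF P] by blast
  define H where "H = R * (- T)"
  have H: "H \<in> carrier_mat (M * m) n"
    using R T by (simp add: H_def)
  have PH: "P * H = - T"
    using assoc_mult_mat[OF P R, of "- T" n] PR T by (simp add: H_def)
  define K where "K j = mat m n (\<lambda>(l, i). H $$ (j * m + l, i))" for j
  have "ltv_state A B u d0 M = 0\<^sub>v n"
    if d0: "d0 \<in> carrier_vec n" and u: "\<forall>j<M. u j = K j *\<^sub>v d0" for d0 u
  proof -
    have "stack_vec m M u = H *\<^sub>v d0"
    proof (rule eq_vecI)
      fix c assume "c < dim_vec (H *\<^sub>v d0)"
      then have c: "c < M * m"
        using H by simp
      note b = div_mod_less_blocks[OF c]
      have "row (K (c div m)) (c mod m) = row H c"
        using b c H by (intro eq_vecI) (auto simp: K_def)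
      then show "stack_vec m M u $ c = (H *\<^sub>v d0) $ c"
        using b c H u by (simp add: stack_vec_def K_def)
    qed (use H in \<open>simp add: stack_vec_def\<close>)
    then have "P *\<^sub>v stack_vec m M u = - T *\<^sub>v d0"
      using assoc_mult_mat_vec[OF P H d0] PH by simp
    moreover have "u j \<in> carrier_vec m" if "j \<le> k" for j
      using that u M by (auto simp: K_def intro: carrier_vecI)
    then have "ltv_state A B u d0 M = T *\<^sub>v d0 + P *\<^sub>v stack_vec m M u"
      unfolding M P_def T_def by (intro ltv_state_eq A B d0)
    moreover have "T *\<^sub>v d0 + - T *\<^sub>v d0 = 0\<^sub>v n"
      using T d0 by (intro eq_vecI) auto
    ultimately show ?thesis
      by simp
  qed
  moreover have "\<forall>j<M. K j \<in> carrier_mat m n"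
    by (simp add: K_def)
  ultimately show ?thesis
    by blast
qed

end
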